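(* Let $\gamma\in\mathbb{R}$, $h\in\mathbb{R}^n$, let $\mathbf{x}=[\underline{x},\overline{x}]\subseteq\mathbb{R}^n$ be a box, $x^0\in\mathbf{x}$, $Q_0>0$, $Q(x)=Q_0+\frac12\|x-x^0\|_2^2$, and assume that the supremum of $E_{\gamma,h}(x)=-\frac{\gamma+\langle h,x\rangle}{Q(x)}$ over $x\in\mathbf{x}$ is positive. With the breakpoints $0=\lambda_1<\dots<\lambda_m<\lambda_{m+1}=+\infty$ and the vectors $p^k,q^k\in\mathbb{R}^n$ ($k=1,\dots,m$) defined in the context, the maximal value of $E_{\gamma,h}$ over $\mathbf{x}$ is the maximum of the piecewise rational function $e(\lambda)$ defined by $$e(\lambda):=\frac{a_k+b_k\lambda}{c_k+d_k\lambda+s_k\lambda^2}\quad\text{if }\lambda\in[\lambda_k,\lambda_{k+1}]\qquad(k=1,2,\dots,m),$$ where $$a_k:=-\gamma-\langle h,p^k\rangle,\qquad b_k:=-\langle h,q^k\rangle,$$ $$c_k:=Q_0+\tfrac12\|p^k-x^0\|_2^2,\qquad d_k:=\langle p^k-x^0,q^k\rangle,\qquad s_k:=\tfrac12\|q^k\|_2^2.$$ Moreover, $c_k>0$, $s_k>0$ and $4s_kc_k>d_k^2$.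
   Context: A box $\mathbf{x}=[\underline{x},\overline{x}]$ is the nonempty set of all $x\in\mathbb{R}^n$ with $\underline{x}_i\le x_i\le\overline{x}_i$ for all $i$, where lower bounds may be $-\infty$ and upper bounds may be $+\infty$. $\langle\cdot,\cdot\rangle$ is the standard inner product on $\mathbb{R}^n$ and $\|\cdot\|_2$ the Euclidean norm. For $i=1,\dots,n$ define $$\widetilde{\lambda}_i:=\begin{cases}-\dfrac{\overline{x}_i-x_i^0}{h_i} & \text{if } h_i<0,\\[2mm] -\dfrac{\underline{x}_i-x_i^0}{h_i} & \text{if } h_i>0,\\[1mm] +\infty & \text{if } h_i=0,\end{cases}$$ which lies in $[0,+\infty]$. Sorting the values $\widetilde{\lambda}_1,\dots,\widetilde{\lambda}_n$ in increasing order, augmenting the list by $0$ and $+\infty$, and deleting duplicates gives the breakpoints $0=\lambda_1<\lambda_2<\dots<\lambda_m<\lambda_{m+1}=+\infty$, $m+1\le n+2$. For $k=m$ the interval $[\lambda_k,\lambda_{k+1}]$ is understood as the set of real $\lambda\ge\lambda_m$. For $k=1,\dots,m$ define $$p_i^k=\begin{cases}x_i^0 & \text{if } h_i=0,\\ x_i^0 & \text{if } \lambda_{k+1}\le\widetilde{\lambda}_i,\\ \underline{x}_i & \text{if } \lambda_k\ge\widetilde{\lambda}_i,\ h_i>0,\\ \overline{x}_i & \text{if } \lambda_k\ge\widetilde{\lambda}_i,\ h_i<0,\end{cases}\qquad q_i^k=\begin{cases}0 & \text{if } h_i=0,\\ -h_i & \text{if } \lambda_{k+1}\le\widetilde{\lambda}_i,\\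 0 & \text{if } \lambda_k\ge\widetilde{\lambda}_i,\ h_i>0,\\ 0 & \text{if } \lambda_k\ge\widetilde{\lambda}_i,\ h_i<0.\end{cases}$$
   Formalization: The claims s_k>0 and 4s_kc_k>d_k² fail for k=m when no i has h_i≠0 and λ̃_i=+∞ (then q^m=0, e.g. n=1, γ=0, h=-1, box [0,1], x⁰=0, Q_0=1); in that case only s_m≥0 and 4s_mc_m≥d_m² are asserted. *)

theory Defs
  imports "HOL-Analysis.Analysis"
begin

text \<open>
  Boxes have bounds in \<open>ereal\<close>, so that \<open>-\<infinity>\<close> and \<open>\<infinity>\<close> are
  allowed, but contain only real vectors. A box is nonempty as soon as it contains the point
  \<open>x0\<close>.
\<close>

definition ebox :: "ereal ^ 'n \<Rightarrow> ereal ^ 'n \<Rightarrow> (real ^ 'n) set" where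
  "ebox l u = {x. \<forall>i. l $ i \<le> ereal (x $ i) \<and> ereal (x $ i) \<le> u $ i}"

definition Qfun :: "real \<Rightarrow> real ^ 'n \<Rightarrow> real ^ 'n \<Rightarrow> real" where
  "Qfun Q0 x0 x = Q0 + 1 / 2 * (norm (x - x0))\<^sup>2"

definition Efun :: "real \<Rightarrow> real ^ 'n \<Rightarrow> real \<Rightarrow> real ^ 'n \<Rightarrow> real ^ 'n \<Rightarrow> real" where
  "Efun \<gamma> h Q0 x0 x = - ((\<gamma> + h \<bullet> x) / Qfun Q0 x0 x)"

text \<open>The maximum is required to be attained.\<close>

definition is_max_value :: "('a \<Rightarrow> real) \<Rightarrow> 'a set \<Rightarrow> real \<Rightarrow> bool" where
  "is_max_value f S M \<longleftrightarrow> (\<exists>x\<in>S. f x = M) \<and> (\<forall>x\<in>S. f x \<le> M)"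

text \<open>The extended real arithmetic gives \<open>\<infinity>\<close> here when the relevant bound is infinite.\<close>

definition lam_tilde ::
  "real ^ 'n \<Rightarrow> ereal ^ 'n \<Rightarrow> ereal ^ 'n \<Rightarrow> real ^ 'n \<Rightarrow> 'n \<Rightarrow> ereal" where
  "lam_tilde h l u x0 i =
     (if h $ i < 0 then - ((u $ i - ereal (x0 $ i)) / ereal (h $ i))
      else if h $ i > 0 then - ((l $ i - ereal (x0 $ i)) / ereal (h $ i))
      else \<infinity>)"

definition breakpoints ::
  "real ^ 'n \<Rightarrow> ereal ^ 'n \<Rightarrow> ereal ^ 'n \<Rightarrow> real ^ 'n \<Rightarrow> ereal list" where
  "breakpoints h l u x0 = sorted_list_of_set ({0, \<infinity>} \<union> range (lam_tilde h l u x0))"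

text \<open>
  Breakpoints are numbered from 1: \<open>lam h l u x0 k\<close> is the \<open>k\<close>-th one, where
  \<open>1 \<le> k \<le> m + 1\<close> and \<open>m = num_pieces h l u x0\<close>.
\<close>

definition num_pieces :: "real ^ 'n \<Rightarrow> ereal ^ 'n \<Rightarrow> ereal ^ 'n \<Rightarrow> real ^ 'n \<Rightarrow> nat" where
  "num_pieces h l u x0 = length (breakpoints h l u x0) - 1"

definition lam :: "real ^ 'n \<Rightarrow> ereal ^ 'n \<Rightarrow> ereal ^ 'n \<Rightarrow> real ^ 'n \<Rightarrow> nat \<Rightarrow> ereal" where
  "lam h l u x0 k = breakpoints h l u x0 ! (k - 1)"

text \<open>For \<open>k = m\<close> the upper end is \<open>\<infinity>\<close>, and the piece is an unbounded set of reals.\<close>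

definition piece :: "real ^ 'n \<Rightarrow> ereal ^ 'n \<Rightarrow> ereal ^ 'n \<Rightarrow> real ^ 'n \<Rightarrow> nat \<Rightarrow> real set" where
  "piece h l u x0 k = {t. lam h l u x0 k \<le> ereal t \<and> ereal t \<le> lam h l u x0 (k + 1)}"

text \<open>
  For \<open>1 \<le> k \<le> m\<close> the final \<open>else\<close> branches of \<open>pvec\<close> and \<open>qvec\<close> are never
  reached, because no \<open>lam_tilde\<close> value lies strictly between consecutive breakpoints. The bound
  passed to \<open>real_of_ereal\<close> is then finite, because \<open>lam h l u x0 k < \<infinity>\<close>.
\<close>

definition pvec ::
  "real ^ 'n \<Rightarrow> ereal ^ 'n \<Rightarrow> ereal ^ 'n \<Rightarrow> real ^ 'n \<Rightarrow> nat \<Rightarrow> real ^ 'n" where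
  "pvec h l u x0 k = (\<chi> i.
     if h $ i = 0 then x0 $ i
     else if lam h l u x0 (k + 1) \<le> lam_tilde h l u x0 i then x0 $ i
     else if lam h l u x0 k \<ge> lam_tilde h l u x0 i \<and> h $ i > 0 then real_of_ereal (l $ i)
     else if lam h l u x0 k \<ge> lam_tilde h l u x0 i \<and> h $ i < 0 then real_of_ereal (u $ i)
     else 0)"

definition qvec ::
  "real ^ 'n \<Rightarrow> ereal ^ 'n \<Rightarrow> ereal ^ 'n \<Rightarrow> real ^ 'n \<Rightarrow> nat \<Rightarrow> real ^ 'n" where
  "qvec h l u x0 k = (\<chi> i.
     if h $ i = 0 then 0
     else if lam h l u x0 (k + 1) \<le> lam_tilde h l u x0 i then - (h $ i)
     else if lam h l u x0 k \<ge> lam_tilde h l u x0 i \<and> h $ i > 0 then 0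
     else if lam h l u x0 k \<ge> lam_tilde h l u x0 i \<and> h $ i < 0 then 0
     else 0)"

definition acoef ::
  "real \<Rightarrow> real ^ 'n \<Rightarrow> ereal ^ 'n \<Rightarrow> ereal ^ 'n \<Rightarrow> real ^ 'n \<Rightarrow> nat \<Rightarrow> real" where
  "acoef \<gamma> h l u x0 k = - \<gamma> - h \<bullet> pvec h l u x0 k"

definition bcoef ::
  "real ^ 'n \<Rightarrow> ereal ^ 'n \<Rightarrow> ereal ^ 'n \<Rightarrow> real ^ 'n \<Rightarrow> nat \<Rightarrow> real" where
  "bcoef h l u x0 k = - (h \<bullet> qvec h l u x0 k)"

definition ccoef ::
  "real ^ 'n \<Rightarrow> real \<Rightarrow> ereal ^ 'n \<Rightarrow> ereal ^ 'n \<Rightarrow> real ^ 'n \<Rightarrow> nat \<Rightarrow> real" where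
  "ccoef h Q0 l u x0 k = Q0 + 1 / 2 * (norm (pvec h l u x0 k - x0))\<^sup>2"

definition dcoef ::
  "real ^ 'n \<Rightarrow> ereal ^ 'n \<Rightarrow> ereal ^ 'n \<Rightarrow> real ^ 'n \<Rightarrow> nat \<Rightarrow> real" where
  "dcoef h l u x0 k = (pvec h l u x0 k - x0) \<bullet> qvec h l u x0 k"

definition scoef ::
  "real ^ 'n \<Rightarrow> ereal ^ 'n \<Rightarrow> ereal ^ 'n \<Rightarrow> real ^ 'n \<Rightarrow> nat \<Rightarrow> real" where
  "scoef h l u x0 k = 1 / 2 * (norm (qvec h l u x0 k))\<^sup>2"

definition epiece ::
  "real \<Rightarrow> real ^ 'n \<Rightarrow> real \<Rightarrow> ereal ^ 'n \<Rightarrow> ereal ^ 'n \<Rightarrow> real ^ 'n \<Rightarrow> nat \<Rightarrow> real \<Rightarrow> real" where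
  "epiece \<gamma> h Q0 l u x0 k t =
     (acoef \<gamma> h l u x0 k + bcoef h l u x0 k * t) /
     (ccoef h Q0 l u x0 k + dcoef h l u x0 k * t + scoef h l u x0 k * t\<^sup>2)"

text \<open>
  The pieces overlap at the breakpoints, so the description singles out a value at \<open>t \<ge> 0\<close>
  only if all pieces containing \<open>t\<close> agree there.
\<close>

definition efun ::
  "real \<Rightarrow> real ^ 'n \<Rightarrow> real \<Rightarrow> ereal ^ 'n \<Rightarrow> ereal ^ 'n \<Rightarrow> real ^ 'n \<Rightarrow> real \<Rightarrow> real" where
  "efun \<gamma> h Q0 l u x0 t =
     (THE v. \<exists>k\<in>{1..num_pieces h l u x0}.
        t \<in> piece h l u x0 k \<and> v = epiece \<gamma> h Q0 l u x0 k t)"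

end

theory Submission
  imports Defs
begin

text \<open>
  On the path \<open>t \<mapsto> x(t)\<close>, where \<open>x(t)\<close> is the point of the box nearest to
  \<open>x0 - t *\<^sub>R h\<close>, the function \<open>e\<close> takes the values of the objective:
  \<open>e(t) = E(x(t))\<close>. The nearest point in a box is found by clamping each coordinate. Coordinate
  \<open>i\<close> of \<open>x(t)\<close> therefore moves linearly from \<open>x0 $ i\<close> with velocity
  \<open>- h $ i\<close> until it hits a bound at time \<open>lam_tilde h l u x0 i\<close>, and then rests there.
  Between consecutive breakpoints no coordinate changes its regime, so
  \<open>x(t) = p\<^sup>k + t q\<^sup>k\<close> (lemma \<open>box_proj_path_on_piece\<close>), and expanding
  \<open>E(p\<^sup>k + t q\<^sup>k)\<close> gives the rational function with coefficients
  \<open>a\<^sub>k, \<dots>, s\<^sub>k\<close>. In particular, all pieces that contain \<open>t\<close> agree there.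

  Since the path stays in the box, \<open>e\<close> never exceeds the maximum of \<open>E\<close>. That this
  maximum \<open>M\<close> is also attained on the path is the idea of Dinkelbach for fractional programs:
  \<open>E x \<le> M\<close> says that \<open>M Q(x) + \<gamma> + \<langle>h, x\<rangle> \<ge> 0\<close>, with equality at
  the maximizers. As \<open>M > 0\<close>, completing the square shows that minimizing this quadratic
  function over the box means finding the point nearest to \<open>x0 - (1/M) h\<close>. That point is
  \<open>x(1/M)\<close>, so \<open>e(1/M) = M\<close> (lemma \<open>Efun_le_at_box_proj\<close>). The maximum
  \<open>M\<close> exists because the numerator of \<open>E\<close> grows linearly and the denominator
  quadratically: far from \<open>x0\<close> the values drop below any given positive one, and compactness
  handles the rest (lemma \<open>Efun_attains_max\<close>).

  A coordinate is either moving, and then \<open>p\<^sup>k\<close> agrees with \<open>x0\<close> in it, or at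
  rest, and then \<open>q\<^sup>k\<close> vanishes in it. So \<open>d\<^sub>k = 0\<close>, and the discriminant
  inequality reduces to the signs of \<open>c\<^sub>k\<close> and \<open>s\<^sub>k\<close>; the latter is positive
  exactly if some coordinate still moves on the \<open>k\<close>-th piece.
\<close>

section \<open>The projected path\<close>

definition box_proj :: "ereal ^ 'n \<Rightarrow> ereal ^ 'n \<Rightarrow> real ^ 'n \<Rightarrow> real ^ 'n" where
  "box_proj l u w = (\<chi> i. real_of_ereal (max (l $ i) (min (u $ i) (ereal (w $ i)))))"

text \<open>
  Clamping a real number to an interval with a real point gives a real number even if bounds are
  infinite, so \<^const>\<open>real_of_ereal\<close> loses nothing.
\<close>

lemma ereal_clamp:
  fixes a b :: ereal
  assumes "a \<le> ereal x" "ereal x \<le> b"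
  shows "ereal (real_of_ereal (max a (min b (ereal w)))) = max a (min b (ereal w))"
  using assms by (cases a; cases b) (auto simp: max_def min_def)

lemma box_proj_in_ebox:
  assumes "x \<in> ebox l u"
  shows "box_proj l u w \<in> ebox l u"
proof -
  have "l $ i \<le> ereal (box_proj l u w $ i) \<and> ereal (box_proj l u w $ i) \<le> u $ i" for i
  proof -
    have lx: "l $ i \<le> ereal (x $ i)" and xu: "ereal (x $ i) \<le> u $ i"
      using assms by (auto simp: ebox_def)
    have "l $ i \<le> u $ i" using lx xu by (rule order_trans)
    then show ?thesis
      by (simp add: box_proj_def ereal_clamp[OF lx xu])
  qed
  then show ?thesis by (simp add: ebox_def)
qed

text \<open>
  Clamping a coordinate minimizes its distance to \<open>w $ i\<close>, and the Euclidean norm is monotone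
  in the absolute values of the coordinates.
\<close>

lemma norm_box_proj_le:
  assumes "x \<in> ebox l u"
  shows "norm (box_proj l u w - w) \<le> norm (x - w)"
proof (rule norm_le_componentwise_cart)
  fix i
  have "l $ i \<le> ereal (x $ i)" "ereal (x $ i) \<le> u $ i"
    using assms by (auto simp: ebox_def)
  then show "norm ((box_proj l u w - w) $ i) \<le> norm ((x - w) $ i)"
    by (cases "l $ i"; cases "u $ i") (auto simp: box_proj_def max_def min_def)
qed

text \<open>
  The number \<^term>\<open>lam_tilde h l u x0 i\<close> is the time at which the \<open>i\<close>-th coordinate of
  \<open>x0 - t *\<^sub>R h\<close> reaches the bound towards which it moves: the lower one if
  \<open>h $ i > 0\<close>, the upper one if \<open>h $ i < 0\<close>. An infinite bound is never reached.
\<close>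

lemma lam_tilde_pos_iff:
  assumes "x0 \<in> ebox l u" "h $ i > 0"
  shows "lam_tilde h l u x0 i \<le> ereal t \<longleftrightarrow> ereal (x0 $ i - t * h $ i) \<le> l $ i"
    and "ereal t \<le> lam_tilde h l u x0 i \<longleftrightarrow> l $ i \<le> ereal (x0 $ i - t * h $ i)"
proof -
  have "l $ i \<le> ereal (x0 $ i)" using assms by (auto simp: ebox_def)
  then show "lam_tilde h l u x0 i \<le> ereal t \<longleftrightarrow> ereal (x0 $ i - t * h $ i) \<le> l $ i"
    and "ereal t \<le> lam_tilde h l u x0 i \<longleftrightarrow> l $ i \<le> ereal (x0 $ i - t * h $ i)"
    using assms(2) by (cases "l $ i"; auto simp: lam_tilde_def field_simps)+
qed

lemma lam_tilde_neg_iff: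
  assumes "x0 \<in> ebox l u" "h $ i < 0"
  shows "lam_tilde h l u x0 i \<le> ereal t \<longleftrightarrow> u $ i \<le> ereal (x0 $ i - t * h $ i)"
    and "ereal t \<le> lam_tilde h l u x0 i \<longleftrightarrow> ereal (x0 $ i - t * h $ i) \<le> u $ i"
proof -
  have "ereal (x0 $ i) \<le> u $ i" using assms by (auto simp: ebox_def)
  then show "lam_tilde h l u x0 i \<le> ereal t \<longleftrightarrow> u $ i \<le> ereal (x0 $ i - t * h $ i)"
    and "ereal t \<le> lam_tilde h l u x0 i \<longleftrightarrow> ereal (x0 $ i - t * h $ i) \<le> u $ i"
    using assms(2) by (cases "u $ i"; auto simp: lam_tilde_def field_simps)+
qed

lemma lam_tilde_nonneg:
  assumes "x0 \<in> ebox l u"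
  shows "0 \<le> lam_tilde h l u x0 i"
proof (cases "h $ i" "0 :: real" rule: linorder_cases)
  case less
  then show ?thesis
    using lam_tilde_neg_iff(2)[OF assms less, of 0] assms by (simp add: ebox_def zero_ereal_def)
next
  case equal
  then show ?thesis by (simp add: lam_tilde_def)
next
  case greater
  then show ?thesis
    using lam_tilde_pos_iff(2)[OF assms greater, of 0] assms by (simp add: ebox_def zero_ereal_def)
qed

lemma box_proj_path_before:
  assumes x0: "x0 \<in> ebox l u" and t: "0 \<le> t" "ereal t \<le> lam_tilde h l u x0 i"
  shows "box_proj l u (x0 - t *\<^sub>R h) $ i = x0 $ i - t * h $ i"
proof -
  have lx: "l $ i \<le> ereal (x0 $ i)" and xu: "ereal (x0 $ i) \<le> u $ i"
    using x0 by (auto simp: ebox_def)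
  have "l $ i \<le> ereal (x0 $ i - t * h $ i) \<and> ereal (x0 $ i - t * h $ i) \<le> u $ i"
  proof (cases "h $ i" "0 :: real" rule: linorder_cases)
    case less
    have "ereal (x0 $ i) \<le> ereal (x0 $ i - t * h $ i)"
      using less t(1) by (simp add: mult_nonneg_nonpos)
    then show ?thesis
      using lam_tilde_neg_iff(2)[OF x0 less] t(2) order_trans[OF lx] by blast
  next
    case equal
    then show ?thesis using lx xu by simp
  next
    case greater
    have "ereal (x0 $ i - t * h $ i) \<le> ereal (x0 $ i)"
      using greater t(1) by simp
    then show ?thesis
      using lam_tilde_pos_iff(2)[OF x0 greater] t(2) order_trans[OF _ xu] by blast
  qed
  then show ?thesis by (simp add: box_proj_def min_absorb2 max_absorb2)
qed

lemma box_proj_path_after: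
  assumes x0: "x0 \<in> ebox l u" and t: "lam_tilde h l u x0 i \<le> ereal t"
  shows "h $ i > 0 \<Longrightarrow> box_proj l u (x0 - t *\<^sub>R h) $ i = real_of_ereal (l $ i)"
    and "h $ i < 0 \<Longrightarrow> box_proj l u (x0 - t *\<^sub>R h) $ i = real_of_ereal (u $ i)"
proof -
  have lu: "l $ i \<le> u $ i"
    using x0 by (auto simp: ebox_def intro: order_trans)
  show "box_proj l u (x0 - t *\<^sub>R h) $ i = real_of_ereal (l $ i)" if "h $ i > 0"
    using lam_tilde_pos_iff(1)[OF x0 that, of t] t order_trans[OF _ lu]
    by (simp add: box_proj_def max_absorb1 min_absorb2)
  show "box_proj l u (x0 - t *\<^sub>R h) $ i = real_of_ereal (u $ i)" if "h $ i < 0"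
    using lam_tilde_neg_iff(1)[OF x0 that, of t] t lu
    by (simp add: box_proj_def max_absorb2 min_absorb1)
qed

section \<open>Breakpoints and pieces\<close>

lemma set_breakpoints:
  "set (breakpoints h l u x0) = {0, \<infinity>} \<union> range (lam_tilde h l u x0)"
  unfolding breakpoints_def by (rule set_sorted_list_of_set) simp

lemma breakpoints_nth_less:
  assumes "i < j" "j < length (breakpoints h l u x0)"
  shows "breakpoints h l u x0 ! i < breakpoints h l u x0 ! j"
  using assms unfolding breakpoints_def
  by (intro sorted_wrt_nth_less[OF strict_sorted_list_of_set])

text \<open>
  This keeps every coordinate in one regime, moving or resting, throughout a piece.
\<close>

lemma breakpoints_not_between:
  assumes "b \<in> set (breakpoints h l u x0)" "Suc j < length (breakpoints h l u x0)"
  shows "b \<le> breakpoints h l u x0 ! j \<or> breakpoints h l u x0 ! Suc j \<le> b"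
proof -
  obtain i where i: "i < length (breakpoints h l u x0)" "b = breakpoints h l u x0 ! i"
    using assms(1) by (auto simp: in_set_conv_nth)
  consider "i < j" | "i = j" | "i = Suc j" | "Suc j < i" by linarith
  then show ?thesis
    using i assms(2) breakpoints_nth_less[of i j h l u x0]
      breakpoints_nth_less[of "Suc j" i h l u x0]
    by cases (auto intro: less_imp_le)
qed

lemma breakpoints_nonneg:
  assumes "x0 \<in> ebox l u" "j < length (breakpoints h l u x0)"
  shows "0 \<le> breakpoints h l u x0 ! j"
  using nth_mem[OF assms(2)] lam_tilde_nonneg[OF assms(1)] by (auto simp: set_breakpoints)

lemma lam_less_lam_Suc:
  assumes "k \<in> {1..num_pieces h l u x0}"
  shows "lam h l u x0 k < lam h l u x0 (k + 1)"
  using assms by (auto simp: lam_def num_pieces_def intro!: breakpoints_nth_less)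

lemma lam_Suc_in_breakpoints:
  assumes "k \<in> {1..num_pieces h l u x0}"
  shows "lam h l u x0 (k + 1) \<in> set (breakpoints h l u x0)"
  using assms by (auto simp: lam_def num_pieces_def intro!: nth_mem)

lemma lam_nonneg:
  assumes "x0 \<in> ebox l u" "k \<in> {1..num_pieces h l u x0}"
  shows "0 \<le> lam h l u x0 k"
  using assms breakpoints_nonneg[OF assms(1), of "k - 1"] by (auto simp: lam_def num_pieces_def)

lemma lam_tilde_not_between_lam:
  assumes "k \<in> {1..num_pieces h l u x0}"
  shows "lam_tilde h l u x0 i \<le> lam h l u x0 k \<or> lam h l u x0 (k + 1) \<le> lam_tilde h l u x0 i"
  using assms breakpoints_not_between[of "lam_tilde h l u x0 i" h l u x0 "k - 1"]
  by (auto simp: lam_def num_pieces_def set_breakpoints)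

lemma piece_nonneg:
  assumes "x0 \<in> ebox l u" "k \<in> {1..num_pieces h l u x0}" "t \<in> piece h l u x0 k"
  shows "0 \<le> t"
  using lam_nonneg[OF assms(1,2)] assms(3) order_trans[of 0 _ "ereal t"] by (auto simp: piece_def)

text \<open>
  The piece of \<open>t\<close> starts at the last breakpoint that is at most \<open>t\<close>. There is one
  because \<open>0\<close> is a breakpoint, and it has a successor because \<open>\<infinity>\<close> is one.
\<close>

lemma pieces_cover:
  assumes x0: "x0 \<in> ebox l u" and t: "0 \<le> t"
  shows "\<exists>k\<in>{1..num_pieces h l u x0}. t \<in> piece h l u x0 k"
proof -
  let ?B = "breakpoints h l u x0"
  define J where "J = {j. j < length ?B \<and> ?B ! j \<le> ereal t}"
  obtain z where z: "z < length ?B" "?B ! z = 0"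
    using set_breakpoints[of h l u x0] by (metis UnI1 in_set_conv_nth insertI1)
  obtain w where w: "w < length ?B" "?B ! w = \<infinity>"
    using set_breakpoints[of h l u x0] by (metis UnI1 in_set_conv_nth insertCI)
  define j where "j = Max J"
  have fin: "finite J" by (simp add: J_def)
  have "z \<in> J" using z t by (simp add: J_def)
  then have j: "j \<in> J" using Max_in[OF fin] by (auto simp: j_def)
  have "Suc j < length ?B"
  proof (rule ccontr)
    assume "\<not> Suc j < length ?B"
    then have "w \<le> j" using w by simp
    then have "?B ! w \<le> ?B ! j"
      using breakpoints_nth_less[of w j h l u x0] j by (cases "w = j") (auto simp: J_def intro: less_imp_le)
    then show False using w j by (auto simp: J_def)
  qed
  moreover have "Suc j \<notin> J" using Max_ge[OF fin, of "Suc j"] by (auto simp: j_def)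
  ultimately have "Suc j \<in> {1..num_pieces h l u x0}" "t \<in> piece h l u x0 (Suc j)"
    using j by (auto simp: J_def num_pieces_def piece_def lam_def)
  then show ?thesis by blast
qed

text \<open>
  In the defining case distinctions of \<open>p\<^sup>k\<close> and \<open>q\<^sup>k\<close>, the first two cases
  describe coordinates that are still moving (with velocity \<open>0\<close> if \<open>h $ i = 0\<close>), and
  the last two describe coordinates that rest at a bound.
\<close>

lemma box_proj_path_on_piece:
  assumes x0: "x0 \<in> ebox l u" and k: "k \<in> {1..num_pieces h l u x0}"
    and t: "t \<in> piece h l u x0 k"
  shows "box_proj l u (x0 - t *\<^sub>R h) = pvec h l u x0 k + t *\<^sub>R qvec h l u x0 k"
proof -
  have t0: "0 \<le> t" by (rule piece_nonneg[OF x0 k t])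
  have lo: "lam h l u x0 k \<le> ereal t" and hi: "ereal t \<le> lam h l u x0 (k + 1)"
    using t by (auto simp: piece_def)
  have "box_proj l u (x0 - t *\<^sub>R h) $ i = (pvec h l u x0 k + t *\<^sub>R qvec h l u x0 k) $ i" for i
  proof (cases "h $ i = 0 \<or> lam h l u x0 (k + 1) \<le> lam_tilde h l u x0 i")
    case True
    then have "ereal t \<le> lam_tilde h l u x0 i"
      using order_trans[OF hi] by (auto simp: lam_tilde_def)
    then show ?thesis
      using box_proj_path_before[OF x0 t0] True by (auto simp: pvec_def qvec_def)
  next
    case False
    then have le: "lam_tilde h l u x0 i \<le> lam h l u x0 k"
      using lam_tilde_not_between_lam[OF k] by blast
    then have "lam_tilde h l u x0 i \<le> ereal t" using lo by (rule order_trans)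
    then show ?thesis
      using box_proj_path_after[OF x0, of h i t] False le
      by (cases "h $ i > 0") (auto simp: pvec_def qvec_def)
  qed
  then show ?thesis by (simp add: vec_eq_iff)
qed

lemma epiece_eq_Efun:
  "epiece \<gamma> h Q0 l u x0 k t =
     Efun \<gamma> h Q0 x0 (pvec h l u x0 k + t *\<^sub>R qvec h l u x0 k)"
proof -
  let ?p = "pvec h l u x0 k" and ?q = "qvec h l u x0 k"
  have "(norm (?p + t *\<^sub>R ?q - x0))\<^sup>2 = (norm ((?p - x0) + t *\<^sub>R ?q))\<^sup>2"
    by (simp add: algebra_simps)
  also have "\<dots> = (norm (?p - x0))\<^sup>2 + 2 * t * ((?p - x0) \<bullet> ?q) + t\<^sup>2 * (norm ?q)\<^sup>2"
    unfolding dot_square_norm[symmetric]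
    by (simp only: inner_add_left inner_add_right inner_scaleR_left inner_scaleR_right
        inner_commute[of ?q "?p - x0"]) (simp add: algebra_simps power2_eq_square)
  finally have Q: "Qfun Q0 x0 (?p + t *\<^sub>R ?q) =
      ccoef h Q0 l u x0 k + dcoef h l u x0 k * t + scoef h l u x0 k * t\<^sup>2"
    by (simp add: Qfun_def ccoef_def dcoef_def scoef_def field_simps)
  have "- (\<gamma> + h \<bullet> (?p + t *\<^sub>R ?q)) = acoef \<gamma> h l u x0 k + bcoef h l u x0 k * t"
    by (simp add: acoef_def bcoef_def inner_add_right)
  then show ?thesis
    unfolding epiece_def Efun_def Q by (metis minus_divide_left)
qed

lemma efun_on_piece:
  assumes "x0 \<in> ebox l u" "k \<in> {1..num_pieces h l u x0}" "t \<in> piece h l u x0 k"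
  shows "efun \<gamma> h Q0 l u x0 t = epiece \<gamma> h Q0 l u x0 k t"
  unfolding efun_def
proof (rule the_equality)
  show "\<exists>k'\<in>{1..num_pieces h l u x0}.
      t \<in> piece h l u x0 k' \<and> epiece \<gamma> h Q0 l u x0 k t = epiece \<gamma> h Q0 l u x0 k' t"
    using assms by blast
next
  fix v
  assume "\<exists>k'\<in>{1..num_pieces h l u x0}.
      t \<in> piece h l u x0 k' \<and> v = epiece \<gamma> h Q0 l u x0 k' t"
  then show "v = epiece \<gamma> h Q0 l u x0 k t"
    using assms by (auto simp: epiece_eq_Efun box_proj_path_on_piece[symmetric])
qed

lemma efun_eq_Efun_box_proj:
  assumes "x0 \<in> ebox l u" "0 \<le> t"
  shows "efun \<gamma> h Q0 l u x0 t = Efun \<gamma> h Q0 x0 (box_proj l u (x0 - t *\<^sub>R h))"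
proof -
  obtain k where k: "k \<in> {1..num_pieces h l u x0}" "t \<in> piece h l u x0 k"
    using pieces_cover[OF assms] by blast
  then show ?thesis
    by (simp add: efun_on_piece[OF assms(1) k] epiece_eq_Efun box_proj_path_on_piece[OF assms(1) k])
qed

section \<open>Attainment of the maximum\<close>

lemma closed_ebox: "closed (ebox l u :: (real ^ 'n) set)"
proof -
  have "closed {x :: real ^ 'n. l $ i \<le> ereal (x $ i) \<and> ereal (x $ i) \<le> u $ i}" for i
    by (intro closed_Collect_conj closed_Collect_le continuous_intros)
  then show ?thesis
    unfolding ebox_def by (intro closed_Collect_all) auto
qed

lemma Qfun_pos: "Q0 > 0 \<Longrightarrow> Qfun Q0 x0 x > 0"
  by (simp add: Qfun_def add_pos_nonneg)

text \<open>
  A positive value \<open>e\<close> at \<open>x1\<close> confines the search to a ball around \<open>x0\<close>: with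
  \<open>r = \<parallel>y - x0\<parallel>\<close> the numerator at \<open>y\<close> is at most \<open>A + \<parallel>h\<parallel> r\<close>,
  while \<open>e\<close> times the denominator exceeds \<open>e r\<^sup>2 / 2\<close>.
\<close>

lemma Efun_attains_max:
  fixes h x0 :: "real ^ 'n"
  assumes S: "closed S" and Q0: "Q0 > 0" and x1: "x1 \<in> S" "Efun \<gamma> h Q0 x0 x1 > 0"
  obtains x where "x \<in> S" "\<And>y. y \<in> S \<Longrightarrow> Efun \<gamma> h Q0 x0 y \<le> Efun \<gamma> h Q0 x0 x"
proof -
  define e where "e = Efun \<gamma> h Q0 x0 x1"
  define A where "A = \<bar>\<gamma> + h \<bullet> x0\<bar>"
  \<comment> \<open>For \<open>r \<ge> R\<close> this gives \<open>A + \<parallel>h\<parallel> r \<le> (A + \<parallel>h\<parallel>) r \<le> e r\<^sup>2 / 2\<close>.\<close>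
  define R where "R = max 1 (2 * (A + norm h) / e)"
  have e: "e > 0" using x1 by (simp add: e_def)
  have far: "Efun \<gamma> h Q0 x0 y < e" if y: "norm (y - x0) \<ge> R" for y
  proof -
    let ?r = "norm (y - x0)"
    have r: "1 \<le> ?r" "2 * (A + norm h) \<le> e * ?r"
      using y e by (auto simp: R_def field_simps)
    have "- (\<gamma> + h \<bullet> y) = - (\<gamma> + h \<bullet> x0) - h \<bullet> (y - x0)"
      by (simp add: inner_diff_right)
    also have "\<dots> \<le> A + norm h * ?r"
      using norm_cauchy_schwarz[of "- h" "y - x0"] by (simp add: A_def)
    also have "\<dots> \<le> (A + norm h) * ?r"
      using r mult_left_mono[of 1 ?r A] by (simp add: A_def algebra_simps)
    also have "\<dots> \<le> e * ?r / 2 * ?r"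
      using r by (intro mult_right_mono) auto
    also have "\<dots> < e * Qfun Q0 x0 y"
      using e Q0 by (simp add: Qfun_def power2_eq_square algebra_simps)
    finally have "- (\<gamma> + h \<bullet> y) < e * Qfun Q0 x0 y" .
    then have "- (\<gamma> + h \<bullet> y) / Qfun Q0 x0 y < e"
      using pos_divide_less_eq[OF Qfun_pos[OF Q0]] by blast
    then show ?thesis by (simp only: Efun_def minus_divide_left)
  qed
  let ?K = "S \<inter> cball x0 R"
  have x1K: "x1 \<in> ?K"
    using x1 far[of x1] by (force simp: e_def dist_norm norm_minus_commute)
  have "continuous_on ?K (Efun \<gamma> h Q0 x0)"
    unfolding Efun_def Qfun_def
    by (intro continuous_intros) (use Qfun_pos[OF Q0, of x0] in \<open>auto simp: Qfun_def dest: less_imp_neq[symmetric]\<close>)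
  moreover have "compact ?K" using S by (simp add: closed_Int_compact)
  ultimately obtain x where x: "x \<in> ?K" "\<And>y. y \<in> ?K \<Longrightarrow> Efun \<gamma> h Q0 x0 y \<le> Efun \<gamma> h Q0 x0 x"
    using continuous_attains_sup[of ?K "Efun \<gamma> h Q0 x0"] x1K by blast
  have "Efun \<gamma> h Q0 x0 y \<le> Efun \<gamma> h Q0 x0 x" if "y \<in> S" for y
  proof (cases "norm (y - x0) \<ge> R")
    case True
    then show ?thesis using far[of y] x(2)[OF x1K] by (simp add: e_def)
  next
    case False
    then show ?thesis using x(2)[of y] that by (simp add: dist_norm norm_minus_commute)
  qed
  then show ?thesis using that[of x] x(1) by blast
qed

text \<open>
  Write \<open>M\<close> for the value at \<open>x\<close>. The function
  \<open>z \<mapsto> M Q(z) + \<gamma> + \<langle>h, z\<rangle>\<close> vanishes at \<open>x\<close>, and up to a constant it is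
  \<open>M/2\<close> times the squared distance to \<open>x0 - (1/M) h\<close>. So it is nonpositive at the nearest
  point, which says that the value of \<open>E\<close> there is at least \<open>M\<close>.
\<close>

lemma Efun_le_at_box_proj:
  fixes h x0 :: "real ^ 'n"
  assumes Q0: "Q0 > 0" and x: "x \<in> ebox l u" and pos: "Efun \<gamma> h Q0 x0 x > 0"
  shows "Efun \<gamma> h Q0 x0 x \<le>
           Efun \<gamma> h Q0 x0 (box_proj l u (x0 - (1 / Efun \<gamma> h Q0 x0 x) *\<^sub>R h))"
proof -
  define M where "M = Efun \<gamma> h Q0 x0 x"
  define w where "w = x0 - (1 / M) *\<^sub>R h"
  define y where "y = box_proj l u w"
  have M: "M > 0" using pos by (simp add: M_def)
  have square: "M / 2 * (norm (z - w))\<^sup>2 =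
      (M * Qfun Q0 x0 z + (\<gamma> + h \<bullet> z)) +
      (h \<bullet> h / (2 * M) - M * Q0 - \<gamma> - h \<bullet> x0)" for z
  proof -
    have "(norm (z - w))\<^sup>2 = (norm ((z - x0) + (1 / M) *\<^sub>R h))\<^sup>2"
      by (simp add: w_def algebra_simps)
    also have "\<dots> = (norm (z - x0))\<^sup>2 + 2 / M * (h \<bullet> (z - x0)) + (h \<bullet> h) / M\<^sup>2"
      unfolding dot_square_norm[symmetric]
      by (simp only: inner_add_left inner_add_right inner_scaleR_left inner_scaleR_right
          inner_commute[of "z - x0" h]) (simp add: algebra_simps power2_eq_square)
    finally show ?thesis
      using M by (simp add: Qfun_def inner_diff_right field_simps power2_eq_square)
  qed
  have "(norm (y - w))\<^sup>2 \<le> (norm (x - w))\<^sup>2"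
    unfolding y_def by (intro power_mono norm_box_proj_le x) simp
  then have "M / 2 * (norm (y - w))\<^sup>2 \<le> M / 2 * (norm (x - w))\<^sup>2"
    using M by (intro mult_left_mono) auto
  then have "M * Qfun Q0 x0 y + (\<gamma> + h \<bullet> y) \<le> M * Qfun Q0 x0 x + (\<gamma> + h \<bullet> x)"
    unfolding square by simp
  also have "\<dots> = 0"
    using Qfun_pos[OF Q0, of x0 x] by (simp add: M_def Efun_def)
  finally have "M * Qfun Q0 x0 y \<le> - (\<gamma> + h \<bullet> y)" by simp
  then have "M \<le> - (\<gamma> + h \<bullet> y) / Qfun Q0 x0 y"
    using pos_le_divide_eq[OF Qfun_pos[OF Q0]] by blast
  then show ?thesis by (simp only: Efun_def minus_divide_left M_def w_def y_def)
qed

section \<open>The coefficients\<close>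

text \<open>
  Each coordinate either has not left \<open>x0\<close> in \<open>p\<^sup>k\<close> or has velocity \<open>0\<close> in
  \<open>q\<^sup>k\<close>, so every summand of the inner product vanishes.
\<close>

lemma dcoef_eq_0: "dcoef h l u x0 k = 0"
  unfolding dcoef_def inner_vec_def by (intro sum.neutral) (simp add: pvec_def qvec_def)

text \<open>
  Some coordinate still moves on the \<open>k\<close>-th piece: if the right end of the piece is finite, it is
  positive and hence the stopping time of some coordinate, which cannot have stopped before. On
  the last piece the assumption provides a coordinate that never stops.
\<close>

lemma scoef_pos:
  assumes x0: "x0 \<in> ebox l u" and k: "k \<in> {1..num_pieces h l u x0}"
    and moving: "k < num_pieces h l u x0 \<or> (\<exists>i. h $ i \<noteq> 0 \<and> lam_tilde h l u x0 i = \<infinity>)"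
  shows "scoef h l u x0 k > 0"
proof -
  have "\<exists>i. h $ i \<noteq> 0 \<and> lam h l u x0 (k + 1) \<le> lam_tilde h l u x0 i"
  proof (cases "lam h l u x0 (k + 1) = \<infinity>")
    case True
    have "\<not> k < num_pieces h l u x0"
      using lam_less_lam_Suc[of "k + 1" h l u x0] True by auto
    then show ?thesis using moving by force
  next
    case False
    have "0 < lam h l u x0 (k + 1)"
      using lam_nonneg[OF x0 k] lam_less_lam_Suc[OF k] by (rule le_less_trans)
    then obtain i where "lam h l u x0 (k + 1) = lam_tilde h l u x0 i"
      using False lam_Suc_in_breakpoints[OF k] by (auto simp: set_breakpoints)
    then show ?thesis using False by (intro exI[of _ i]) (auto simp: lam_tilde_def)
  qed
  then obtain i where "h $ i \<noteq> 0" "lam h l u x0 (k + 1) \<le> lam_tilde h l u x0 i" by blast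
  then have "qvec h l u x0 k $ i \<noteq> 0" by (simp add: qvec_def)
  then have "qvec h l u x0 k \<noteq> 0" by auto
  then show ?thesis by (simp add: scoef_def)
qed

section \<open>The maximum of the piecewise rational function\<close>

theorem proposition3p4:
  fixes \<gamma> Q0 :: real
    and h x0 :: "real ^ 'n"
    and l u :: "ereal ^ 'n"
  assumes "x0 \<in> ebox l u"
    and "Q0 > 0"
    and "(SUP x\<in>ebox l u. ereal (Efun \<gamma> h Q0 x0 x)) > 0"
  shows "(\<forall>k\<in>{1..num_pieces h l u x0}. \<forall>t\<in>piece h l u x0 k.
            efun \<gamma> h Q0 l u x0 t = epiece \<gamma> h Q0 l u x0 k t) \<and>
         (\<exists>M. is_max_value (Efun \<gamma> h Q0 x0) (ebox l u) M \<and>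
              is_max_value (efun \<gamma> h Q0 l u x0) {0..} M) \<and>
         (\<forall>k\<in>{1..num_pieces h l u x0}.
            ccoef h Q0 l u x0 k > 0 \<and>
            scoef h l u x0 k \<ge> 0 \<and>
            4 * scoef h l u x0 k * ccoef h Q0 l u x0 k \<ge> (dcoef h l u x0 k)\<^sup>2 \<and>
            (k < num_pieces h l u x0 \<or> (\<exists>i. h $ i \<noteq> 0 \<and> lam_tilde h l u x0 i = \<infinity>) \<longrightarrow>
               scoef h l u x0 k > 0 \<and>
               4 * scoef h l u x0 k * ccoef h Q0 l u x0 k > (dcoef h l u x0 k)\<^sup>2))"
proof (intro conjI)
  show "\<forall>k\<in>{1..num_pieces h l u x0}. \<forall>t\<in>piece h l u x0 k.
      efun \<gamma> h Q0 l u x0 t = epiece \<gamma> h Q0 l u x0 k t"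
    using efun_on_piece[OF assms(1)] by blast
next
  obtain x1 where x1: "x1 \<in> ebox l u" "Efun \<gamma> h Q0 x0 x1 > 0"
    using assms(3) by (auto simp: less_SUP_iff)
  obtain x where x: "x \<in> ebox l u"
      and max: "\<And>y. y \<in> ebox l u \<Longrightarrow> Efun \<gamma> h Q0 x0 y \<le> Efun \<gamma> h Q0 x0 x"
    using Efun_attains_max[OF closed_ebox assms(2) x1] by metis
  define M where "M = Efun \<gamma> h Q0 x0 x"
  have M: "M > 0" using max[OF x1(1)] x1(2) by (simp add: M_def)
  have le: "efun \<gamma> h Q0 l u x0 t \<le> M" if "t \<ge> 0" for t
    using efun_eq_Efun_box_proj[OF assms(1) that, of \<gamma> h Q0] max[OF box_proj_in_ebox[OF assms(1)]]
    by (simp add: M_def)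
  have "M \<le> efun \<gamma> h Q0 l u x0 (1 / M)"
    using Efun_le_at_box_proj[OF assms(2) x, of \<gamma> h x0] M
      efun_eq_Efun_box_proj[OF assms(1), of "1 / M" \<gamma> h Q0]
    by (simp add: M_def)
  then have "efun \<gamma> h Q0 l u x0 (1 / M) = M" using le[of "1 / M"] M by simp
  then have "is_max_value (efun \<gamma> h Q0 l u x0) {0..} M"
    unfolding is_max_value_def using le M by (auto intro!: bexI[of _ "1 / M"])
  moreover have "is_max_value (Efun \<gamma> h Q0 x0) (ebox l u) M"
    unfolding is_max_value_def using x max by (auto simp: M_def)
  ultimately show "\<exists>M. is_max_value (Efun \<gamma> h Q0 x0) (ebox l u) M \<and>
      is_max_value (efun \<gamma> h Q0 l u x0) {0..} M" by blast
next
  have "ccoef h Q0 l u x0 k > 0" for k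
    using assms(2) by (simp add: ccoef_def add_pos_nonneg)
  moreover have "scoef h l u x0 k \<ge> 0" for k
    by (simp add: scoef_def)
  ultimately show "\<forall>k\<in>{1..num_pieces h l u x0}.
      ccoef h Q0 l u x0 k > 0 \<and>
      scoef h l u x0 k \<ge> 0 \<and>
      4 * scoef h l u x0 k * ccoef h Q0 l u x0 k \<ge> (dcoef h l u x0 k)\<^sup>2 \<and>
      (k < num_pieces h l u x0 \<or> (\<exists>i. h $ i \<noteq> 0 \<and> lam_tilde h l u x0 i = \<infinity>) \<longrightarrow>
         scoef h l u x0 k > 0 \<and>
         4 * scoef h l u x0 k * ccoef h Q0 l u x0 k > (dcoef h l u x0 k)\<^sup>2)"
    using scoef_pos[OF assms(1)] by (simp add: dcoef_eq_0 less_imp_le)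
qed

end
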